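(* Let $\kappa$ be a cardinal and $U$ an ultrafilter over $\kappa$. The collection of $U$-measurable subsets of ${}^{\omega}\kappa$ is closed under Suslin's operation $\mathcal{A}$: if $X_\tau\subseteq{}^{\omega}\kappa$ is $U$-measurable for each $\tau\in{}^{<\omega}\omega$, then $\bigcup_{f\in{}^{\omega}\omega}\bigcap_{n<\omega}X_{f\restriction n}$ is $U$-measurable.
   Context: ${}^{<\omega}\kappa$ is the set of finite sequences from $\kappa$; $\frown$ is concatenation, $\langle\rangle$ the empty sequence. A tree is a subset of ${}^{<\omega}\kappa$ closed under initial segments; $[T]$ is the set of infinite branches of $T$. For $X\subseteq{}^{\omega}\kappa$ and $\sigma\in{}^{<\omega}\kappa$, $X\lfloor\sigma=\{s:\sigma\frown s\in X\}$. A tree $T$ is $U$-branching iff $\langle\rangle\in T$ and for each $\sigma\in T$, $\{\alpha\in\kappa:\sigma\frown\langle\alpha\rangle\in T\}\in U$. $X$ is $U$-large (resp. $U$-small) iff there is a $U$-branching tree $T$ with $[T]\subseteq X$ (resp. $[T]\cap X=\emptyset$); $X$ is $U$-determined iff it is $U$-large or $U$-small; $X$ is $U$-measurable iff $X\lfloor\sigma$ is $U$-determined for every $\sigma\in{}^{<\omega}\kappa$. *)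

theory Defs
  imports Main "HOL-Library.Omega_Words_Fun"
begin

text \<open>
  The cardinal \<open>\<kappa>\<close> enters only through its underlying set \<open>K\<close>. Finite sequences from \<open>K\<close> are
  \<open>lists K\<close>, infinite ones are functions on \<open>nat\<close> with values in \<open>K\<close>; \<open>\<sigma> \<frown> s\<close> and \<open>prefix n f\<close>
  (the restriction of \<open>f\<close> to \<open>n\<close>) are those of \<^theory>\<open>HOL-Library.Omega_Words_Fun\<close>.
\<close>

definition ultrafilter_on :: "'a set \<Rightarrow> 'a set set \<Rightarrow> bool" where
  "ultrafilter_on K U \<longleftrightarrow>
     U \<subseteq> Pow K \<and> K \<in> U \<and> {} \<notin> U \<and>
     (\<forall>A\<in>U. \<forall>B\<in>U. A \<inter> B \<in> U) \<and>
     (\<forall>A\<in>U. \<forall>B. A \<subseteq> B \<and> B \<subseteq> K \<longrightarrow> B \<in> U) \<and>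
     (\<forall>A. A \<subseteq> K \<longrightarrow> A \<in> U \<or> K - A \<in> U)"

definition inf_seqs :: "'a set \<Rightarrow> (nat \<Rightarrow> 'a) set" where
  "inf_seqs K = {f. \<forall>n. f n \<in> K}"

definition seq_tree :: "'a set \<Rightarrow> 'a list set \<Rightarrow> bool" where
  "seq_tree K T \<longleftrightarrow> T \<subseteq> lists K \<and> (\<forall>\<sigma> \<tau>. \<sigma> @ \<tau> \<in> T \<longrightarrow> \<sigma> \<in> T)"

definition branches :: "'a set \<Rightarrow> 'a list set \<Rightarrow> (nat \<Rightarrow> 'a) set" where
  "branches K T = {f \<in> inf_seqs K. \<forall>n. prefix n f \<in> T}"

definition section_at :: "'a set \<Rightarrow> (nat \<Rightarrow> 'a) set \<Rightarrow> 'a list \<Rightarrow> (nat \<Rightarrow> 'a) set" where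
  "section_at K X \<sigma> = {s \<in> inf_seqs K. \<sigma> \<frown> s \<in> X}"

definition U_branching :: "'a set \<Rightarrow> 'a set set \<Rightarrow> 'a list set \<Rightarrow> bool" where
  "U_branching K U T \<longleftrightarrow>
     seq_tree K T \<and> [] \<in> T \<and> (\<forall>\<sigma>\<in>T. {\<alpha> \<in> K. \<sigma> @ [\<alpha>] \<in> T} \<in> U)"

definition U_large :: "'a set \<Rightarrow> 'a set set \<Rightarrow> (nat \<Rightarrow> 'a) set \<Rightarrow> bool" where
  "U_large K U X \<longleftrightarrow> (\<exists>T. U_branching K U T \<and> branches K T \<subseteq> X)"

definition U_small :: "'a set \<Rightarrow> 'a set set \<Rightarrow> (nat \<Rightarrow> 'a) set \<Rightarrow> bool" where
  "U_small K U X \<longleftrightarrow> (\<exists>T. U_branching K U T \<and> branches K T \<inter> X = {})"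

definition U_determined :: "'a set \<Rightarrow> 'a set set \<Rightarrow> (nat \<Rightarrow> 'a) set \<Rightarrow> bool" where
  "U_determined K U X \<longleftrightarrow> U_large K U X \<or> U_small K U X"

definition U_measurable :: "'a set \<Rightarrow> 'a set set \<Rightarrow> (nat \<Rightarrow> 'a) set \<Rightarrow> bool" where
  "U_measurable K U X \<longleftrightarrow>
     X \<subseteq> inf_seqs K \<and> (\<forall>\<sigma>\<in>lists K. U_determined K U (section_at K X \<sigma>))"

end

theory Submission
  imports Defs "HOL-Library.Countable"
begin

text \<open>
  Call a set \<^emph>\<open>null\<close> if all its sections are \<open>U\<close>-small. A fusion argument shows that null sets are
  closed under countable unions, although \<open>U\<close> need not be countably complete: the constraint coming
  from the \<open>j\<close>-th set is imposed only from level \<open>j\<close> on. For the Suslin scheme let \<open>A\<^sub>\<tau>\<close> be the union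
  over the \<open>f\<close> extending \<open>\<tau>\<close>, and let \<open>C\<^sub>\<tau>\<close> consist of the sequences with \<open>A\<^sub>\<tau>\<close> not small at almost
  all of their initial segments; it is a hull of \<open>A\<^sub>\<tau>\<close> up to null sets. Measurability of \<open>X\<^sub>\<tau>\<close> makes
  \<open>C\<^sub>\<tau> - X\<^sub>\<tau>\<close> null, and \<open>C\<^sub>\<tau> - (\<Union>n. C\<^bsub>\<tau>\<frown>n\<^esub>)\<close> is null as well. If \<open>A = A\<^bsub>\<langle>\<rangle>\<^esub>\<close> is not small at \<open>\<sigma>\<close>, then
  some tree above \<open>\<sigma>\<close> has all its branches in \<open>C\<^bsub>\<langle>\<rangle>\<^esub>\<close> and outside all these null sets, and such
  branches lie in \<open>A\<close>.
\<close>

section \<open>Sequences obeying successor sets, and Suslin schemes\<close>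

definition follows :: "('a list \<Rightarrow> 'a set) \<Rightarrow> nat \<Rightarrow> (nat \<Rightarrow> 'a) \<Rightarrow> bool" where
  "follows W n f \<longleftrightarrow> (\<forall>i\<ge>n. f i \<in> W (prefix i f))"

lemma follows_mono:
  assumes "follows W n f" "n \<le> m" "\<And>i. i \<ge> m \<Longrightarrow> W (prefix i f) \<subseteq> V (prefix i f)"
  shows "follows V m f"
  unfolding follows_def
proof (intro allI impI)
  fix i
  assume "m \<le> i"
  with assms(1,2) have "f i \<in> W (prefix i f)"
    unfolding follows_def by simp
  with assms(3)[OF \<open>m \<le> i\<close>] show "f i \<in> V (prefix i f)" ..
qed

definition suslin_above :: "(nat list \<Rightarrow> 'b set) \<Rightarrow> nat list \<Rightarrow> 'b set" where
  "suslin_above X \<tau> = (\<Union>g \<in> {g. prefix (length \<tau>) g = \<tau>}. \<Inter>n. X (prefix n g))"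

lemma suslin_above_Nil: "suslin_above X [] = (\<Union>g. \<Inter>n. X (prefix n g))"
  by (simp add: suslin_above_def)

lemma suslin_above_subset: "suslin_above X \<tau> \<subseteq> X \<tau>"
proof
  fix f
  assume "f \<in> suslin_above X \<tau>"
  then obtain g where "prefix (length \<tau>) g = \<tau>" "\<And>n. f \<in> X (prefix n g)"
    unfolding suslin_above_def by blast
  then show "f \<in> X \<tau>"
    by metis
qed

lemma suslin_above_step: "suslin_above X \<tau> = (\<Union>n. suslin_above X (\<tau> @ [n]))"
proof -
  have "{g. prefix (length \<tau>) g = \<tau>} = (\<Union>n. {g. prefix (length (\<tau> @ [n])) g = \<tau> @ [n]})"
    by simp blast
  then show ?thesis
    unfolding suslin_above_def by (simp only: UN_UN_flatten)
qed

text \<open>Iterated choice; it supplies the single \<open>g\<close> that witnesses membership in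
  the result of Suslin's operation.\<close>

lemma prefix_chain_exists:
  assumes "P []" and step: "\<And>\<tau>. P \<tau> \<Longrightarrow> \<exists>n. P (\<tau> @ [n])"
  shows "\<exists>g. \<forall>k. P (prefix k g)"
proof -
  define next_entry where "next_entry \<tau> = (SOME n. P (\<tau> @ [n]))" for \<tau>
  define h where "h = rec_nat [] (\<lambda>_ \<tau>. \<tau> @ [next_entry \<tau>])"
  define g where "g k = next_entry (h k)" for k
  have h: "prefix k g = h k" for k
    by (induction k) (simp_all add: h_def g_def)
  have "P (h k)" for k
    by (induction k) (simp_all add: h_def \<open>P []\<close> next_entry_def someI_ex[OF step])
  then show ?thesis
    by (intro exI[of _ g]) (simp add: h)
qed

section \<open>Ultrafilters\<close>

locale ultrafilter_set =
  fixes K :: "'a set" and U :: "'a set set"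
  assumes ultrafilter: "ultrafilter_on K U"
begin

lemma subset_K: "A \<in> U \<Longrightarrow> A \<subseteq> K"
  using ultrafilter unfolding ultrafilter_on_def by (elim conjE) (drule subsetD, assumption, simp)

lemma K_in_U: "K \<in> U"
  using ultrafilter unfolding ultrafilter_on_def by (elim conjE)

lemma Int_in_U: "A \<in> U \<Longrightarrow> B \<in> U \<Longrightarrow> A \<inter> B \<in> U"
  using ultrafilter unfolding ultrafilter_on_def by simp

lemma superset_in_U: "A \<in> U \<Longrightarrow> A \<subseteq> B \<Longrightarrow> B \<subseteq> K \<Longrightarrow> B \<in> U"
  using ultrafilter unfolding ultrafilter_on_def by (elim conjE) metis

lemma diff_in_U: "A \<subseteq> K \<Longrightarrow> A \<notin> U \<Longrightarrow> K - A \<in> U"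
  using ultrafilter unfolding ultrafilter_on_def by (elim conjE) metis

lemma finite_Int_in_U: "(\<And>j. j \<le> (n::nat) \<Longrightarrow> A j \<in> U) \<Longrightarrow> (\<Inter>j\<le>n. A j) \<in> U"
proof (induction n)
  case (Suc n)
  then show ?case
    by (simp add: atMost_Suc Int_in_U)
qed simp

text \<open>
  A \<open>U\<close>-branching tree above \<open>\<sigma>\<close> is encoded by a function \<open>W\<close> with values in \<open>U\<close>, defined on all lists
  and giving the admissible successors; no pruning or concatenation is then needed.
\<close>

definition small_at :: "(nat \<Rightarrow> 'a) set \<Rightarrow> 'a list \<Rightarrow> bool" where
  "small_at X \<sigma> \<longleftrightarrow>
     (\<exists>W. (\<forall>\<rho>. W \<rho> \<in> U) \<and> (\<forall>f\<in>X. prefix (length \<sigma>) f = \<sigma> \<longrightarrow> \<not> follows W (length \<sigma>) f))"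

text \<open>One \<open>W\<close> serves all stems and starting levels at once;
  \<open>null_imp_small_at\<close> and \<open>nullI\<close> show that this amounts to smallness at
  every stem.\<close>

definition null :: "(nat \<Rightarrow> 'a) set \<Rightarrow> bool" where
  "null X \<longleftrightarrow> (\<exists>W. (\<forall>\<rho>. W \<rho> \<in> U) \<and> (\<forall>f\<in>X. \<forall>n. \<not> follows W n f))"

section \<open>Translation between branching trees and successor functions\<close>

lemma U_small_section_iff:
  assumes \<sigma>: "\<sigma> \<in> lists K"
  shows "U_small K U (section_at K X \<sigma>) \<longleftrightarrow> small_at X \<sigma>"
proof
  assume "U_small K U (section_at K X \<sigma>)"
  then obtain T where T: "U_branching K U T" and disj: "branches K T \<inter> section_at K X \<sigma> = {}"
    unfolding U_small_def by blast
  \<comment> \<open>\<open>drop\<close> strips the stem. Off \<open>T\<close> the default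
    \<open>K\<close> merely keeps the value in \<open>U\<close>: a sequence that extends the stem
    and follows \<open>W\<close> from there never leaves \<open>T\<close>.\<close>
  define W where "W \<rho> = (if drop (length \<sigma>) \<rho> \<in> T
      then {\<alpha> \<in> K. drop (length \<sigma>) \<rho> @ [\<alpha>] \<in> T} else K)" for \<rho>
  have W: "W \<rho> \<in> U" for \<rho>
    using T K_in_U unfolding U_branching_def W_def by auto
  have "f \<notin> X" if f: "prefix (length \<sigma>) f = \<sigma>" "follows W (length \<sigma>) f" for f
  proof -
    define g where "g = suffix (length \<sigma>) f"
    have fg: "f = \<sigma> \<frown> g"
      using f(1) prefix_suffix[of f "length \<sigma>"] unfolding g_def by metis
    have g: "g i \<in> W (\<sigma> @ prefix i g)" for i
      using f(2) unfolding follows_def fg by (auto dest: spec[of _ "length \<sigma> + i"])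
    then have "g \<in> inf_seqs K"
      using subset_K[OF W] unfolding inf_seqs_def by blast
    moreover have "prefix i g \<in> T" for i
    proof (induction i)
      case 0
      then show ?case using T by (simp add: U_branching_def)
    next
      case (Suc i)
      then show ?case using g[of i] by (simp add: W_def)
    qed
    ultimately show ?thesis
      using disj unfolding branches_def section_at_def fg by blast
  qed
  then show "small_at X \<sigma>"
    unfolding small_at_def using W by blast
next
  assume "small_at X \<sigma>"
  then obtain W where W: "\<And>\<rho>. W \<rho> \<in> U"
    and X: "\<And>f. f \<in> X \<Longrightarrow> prefix (length \<sigma>) f = \<sigma> \<Longrightarrow> \<not> follows W (length \<sigma>) f"
    unfolding small_at_def by blast
  \<comment> \<open>The finite sequences that obey \<open>W\<close> once the stem is put in
    front.\<close>
  define T where "T = {\<rho> \<in> lists K. \<forall>i<length \<rho>. \<rho> ! i \<in> W (\<sigma> @ take i \<rho>)}"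
  have "\<rho> \<in> T" if "\<rho> @ \<rho>' \<in> T" for \<rho> \<rho>'
  proof -
    have "\<rho> ! i \<in> W (\<sigma> @ take i \<rho>)" if "i < length \<rho>" for i
      using \<open>\<rho> @ \<rho>' \<in> T\<close> that unfolding T_def
      by (auto simp: nth_append dest!: spec[of _ i])
    then show ?thesis
      using that unfolding T_def by auto
  qed
  moreover have "{\<alpha> \<in> K. \<rho> @ [\<alpha>] \<in> T} \<in> U" if "\<rho> \<in> T" for \<rho>
  proof (rule superset_in_U[OF W[of "\<sigma> @ \<rho>"]])
    show "W (\<sigma> @ \<rho>) \<subseteq> {\<alpha> \<in> K. \<rho> @ [\<alpha>] \<in> T}"
      using that subset_K[OF W] unfolding T_def by (auto simp: nth_append less_Suc_eq)
  qed auto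
  ultimately have "U_branching K U T"
    unfolding U_branching_def seq_tree_def by (auto simp: T_def)
  moreover have "branches K T \<inter> section_at K X \<sigma> = {}"
  proof -
    have "\<sigma> \<frown> g \<notin> X" if "g \<in> branches K T" for g
    proof
      assume "\<sigma> \<frown> g \<in> X"
      then have "\<not> follows W (length \<sigma>) (\<sigma> \<frown> g)"
        using X by simp
      then obtain i where i: "i \<ge> length \<sigma>" "g (i - length \<sigma>) \<notin> W (\<sigma> @ prefix (i - length \<sigma>) g)"
        unfolding follows_def by auto
      \<comment> \<open>One entry more than the offending position, so that membership in
        \<open>T\<close> constrains that position.\<close>
      have "prefix (Suc (i - length \<sigma>)) g \<in> T"
        using that unfolding branches_def by blast
      then show False
        using i(2) unfolding T_def by (auto simp del: subseq_to_Suc dest!: spec[of _ "i - length \<sigma>"])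
    qed
    then show ?thesis
      unfolding section_at_def by blast
  qed
  ultimately show "U_small K U (section_at K X \<sigma>)"
    unfolding U_small_def by blast
qed

text \<open>The complement \<open>- X\<close> also contains sequences that leave \<open>K\<close>,
  but branches never do; so avoiding \<open>- X\<close> is the same as lying in
  \<open>X\<close>.\<close>

lemma U_large_section_iff:
  assumes "\<sigma> \<in> lists K"
  shows "U_large K U (section_at K X \<sigma>) \<longleftrightarrow> small_at (- X) \<sigma>"
proof -
  have "branches K T \<subseteq> section_at K X \<sigma> \<longleftrightarrow> branches K T \<inter> section_at K (- X) \<sigma> = {}" for T
    unfolding section_at_def branches_def by blast
  then show ?thesis
    using U_small_section_iff[OF assms, of "- X"] unfolding U_large_def U_small_def by simp
qed

lemma U_measurable_iff:
  "U_measurable K U X \<longleftrightarrow>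
     X \<subseteq> inf_seqs K \<and> (\<forall>\<sigma>\<in>lists K. small_at (- X) \<sigma> \<or> small_at X \<sigma>)"
  by (simp add: U_measurable_def U_determined_def U_large_section_iff U_small_section_iff)

section \<open>Smallness at a stem, null sets and fusion\<close>

lemma small_at_subset:
  assumes "small_at X \<sigma>" "Y \<subseteq> X"
  shows "small_at Y \<sigma>"
proof -
  from assms(1) obtain W where "\<forall>\<rho>. W \<rho> \<in> U"
    and "\<forall>f\<in>X. prefix (length \<sigma>) f = \<sigma> \<longrightarrow> \<not> follows W (length \<sigma>) f"
    unfolding small_at_def by (elim exE conjE)
  with assms(2) show ?thesis
    unfolding small_at_def by (intro exI[of _ W]) blast
qed

lemma small_at_Un:
  assumes "small_at X \<sigma>" "small_at Y \<sigma>"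
  shows "small_at (X \<union> Y) \<sigma>"
proof -
  from assms obtain V W where V: "\<And>\<rho>. V \<rho> \<in> U"
      "\<And>f. f \<in> X \<Longrightarrow> prefix (length \<sigma>) f = \<sigma> \<Longrightarrow> \<not> follows V (length \<sigma>) f"
    and W: "\<And>\<rho>. W \<rho> \<in> U"
      "\<And>f. f \<in> Y \<Longrightarrow> prefix (length \<sigma>) f = \<sigma> \<Longrightarrow> \<not> follows W (length \<sigma>) f"
    unfolding small_at_def by blast
  show ?thesis
    unfolding small_at_def
  proof (intro exI[of _ "\<lambda>\<rho>. V \<rho> \<inter> W \<rho>"] conjI allI ballI impI notI)
    fix f
    assume f: "f \<in> X \<union> Y" "prefix (length \<sigma>) f = \<sigma>" "follows (\<lambda>\<rho>. V \<rho> \<inter> W \<rho>) (length \<sigma>) f"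
    from f(3) have "follows V (length \<sigma>) f" "follows W (length \<sigma>) f"
      unfolding follows_def by auto
    with f(1,2) V(2) W(2) show False by blast
  qed (simp add: Int_in_U V W)
qed

lemma null_imp_small_at:
  assumes "null X"
  shows "small_at X \<sigma>"
proof -
  from assms obtain W where "\<forall>\<rho>. W \<rho> \<in> U" "\<forall>f\<in>X. \<forall>n. \<not> follows W n f"
    unfolding null_def by (elim exE conjE)
  then show ?thesis
    unfolding small_at_def by (intro exI[of _ W]) simp
qed

text \<open>Diagonalize: at \<open>\<rho>\<close>, intersect the codes chosen for the finitely many
  initial segments of \<open>\<rho>\<close>. Whatever follows the result from \<open>n\<close> on
  then follows the code chosen for its own prefix of length \<open>n\<close>.\<close>

lemma nullI:
  assumes "\<And>\<sigma>. small_at X \<sigma>"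
  shows "null X"
proof -
  from assms obtain V where V: "\<And>\<sigma> \<rho>. V \<sigma> \<rho> \<in> U"
    and X: "\<And>\<sigma> f. f \<in> X \<Longrightarrow> prefix (length \<sigma>) f = \<sigma> \<Longrightarrow> \<not> follows (V \<sigma>) (length \<sigma>) f"
    unfolding small_at_def by metis
  define W where "W \<rho> = (\<Inter>j\<le>length \<rho>. V (take j \<rho>) \<rho>)" for \<rho>
  have W: "W \<rho> \<in> U" for \<rho>
    unfolding W_def by (rule finite_Int_in_U) (rule V)
  have "\<not> follows W n f" if "f \<in> X" for f n
  proof
    assume "follows W n f"
    then have "follows (V (prefix n f)) n f"
      by (rule follows_mono) (auto simp: W_def dest: bspec[of _ _ n])
    then show False
      using X[OF that, of "prefix n f"] by simp
  qed
  with W show ?thesis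
    unfolding null_def by blast
qed

text \<open>The code \<open>V j\<close> enters only from level \<open>j\<close> on, which keeps
  every intersection finite. Nothing is lost, since nullity of \<open>X j\<close> excludes every
  starting level, in particular \<open>max j n\<close>.\<close>

lemma null_UN:
  assumes "\<And>j::nat. null (X j)"
  shows "null (\<Union>j. X j)"
proof -
  from assms obtain V where V: "\<And>j \<rho>. V j \<rho> \<in> U"
    and X: "\<And>j f n. f \<in> X j \<Longrightarrow> \<not> follows (V j) n f"
    unfolding null_def by metis
  define W where "W \<rho> = (\<Inter>j\<le>length \<rho>. V j \<rho>)" for \<rho>
  have W: "W \<rho> \<in> U" for \<rho>
    unfolding W_def by (rule finite_Int_in_U) (rule V)
  have "\<not> follows W n f" if "f \<in> X j" for f j n
  proof
    assume "follows W n f"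
    then have "follows (V j) (max j n) f"
      by (rule follows_mono) (auto simp: W_def)
    then show False
      using X[OF that] by simp
  qed
  with W show ?thesis
    unfolding null_def by blast
qed

lemma null_UN_countable:
  fixes X :: "'i::countable \<Rightarrow> (nat \<Rightarrow> 'a) set"
  assumes "\<And>i. null (X i)"
  shows "null (\<Union>i. X i)"
proof -
  have "(\<Union>i. X i) = (\<Union>j. X (from_nat j))"
    by (simp only: image_image[symmetric, of X from_nat] surj_from_nat)
  moreover have "null (\<Union>j. X (from_nat j))"
    by (rule null_UN) (rule assms)
  ultimately show ?thesis
    by (simp only:)
qed

section \<open>Passing between a stem and its one-entry extensions\<close>

definition preserve :: "'a list set \<Rightarrow> 'a list \<Rightarrow> 'a set" where
  "preserve P \<sigma> = {\<alpha> \<in> K. \<sigma> @ [\<alpha>] \<in> P \<longleftrightarrow> \<sigma> \<in> P}"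

lemma follows_preserve:
  assumes "follows (preserve P) n f" "n \<le> i"
  shows "prefix i f \<in> P \<longleftrightarrow> prefix n f \<in> P"
  using assms(2)
proof (induction i rule: dec_induct)
  case (step i)
  have "f i \<in> preserve P (prefix i f)"
    using assms(1) step.hyps unfolding follows_def by simp
  with step show ?case
    by (simp add: preserve_def)
qed simp

text \<open>The code for the stem also serves each extension by an entry of
  \<open>W \<sigma>\<close>: following it from there is following it from the stem.\<close>

lemma small_at_snoc:
  assumes "small_at X \<sigma>"
  shows "{\<alpha> \<in> K. small_at X (\<sigma> @ [\<alpha>])} \<in> U"
proof -
  from assms obtain W where W: "\<And>\<rho>. W \<rho> \<in> U"
    and X: "\<And>f. f \<in> X \<Longrightarrow> prefix (length \<sigma>) f = \<sigma> \<Longrightarrow> \<not> follows W (length \<sigma>) f"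
    unfolding small_at_def by blast
  have "small_at X (\<sigma> @ [\<alpha>])" if "\<alpha> \<in> W \<sigma>" for \<alpha>
    unfolding small_at_def
  proof (intro exI[of _ W] conjI allI ballI impI notI W)
    fix f
    assume f: "f \<in> X" "prefix (length (\<sigma> @ [\<alpha>])) f = \<sigma> @ [\<alpha>]" "follows W (length (\<sigma> @ [\<alpha>])) f"
    then have "prefix (length \<sigma>) f = \<sigma>" "f (length \<sigma>) = \<alpha>"
      by simp_all
    with f(3) that have "follows W (length \<sigma>) f"
      unfolding follows_def by (auto simp: le_eq_less_or_eq[of "length \<sigma>"] Suc_le_eq)
    with X f \<open>prefix (length \<sigma>) f = \<sigma>\<close> show False
      by blast
  qed
  then show ?thesis
    using subset_K[OF W] by (intro superset_in_U[OF W[of \<sigma>]]) auto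
qed

lemma small_at_of_snoc:
  assumes "{\<alpha> \<in> K. small_at X (\<sigma> @ [\<alpha>])} \<in> U" (is "?A \<in> U")
  shows "small_at X \<sigma>"
proof -
  have "\<forall>\<alpha>. \<exists>W. small_at X (\<sigma> @ [\<alpha>]) \<longrightarrow> (\<forall>\<rho>. W \<rho> \<in> U) \<and>
      (\<forall>f\<in>X. prefix (length (\<sigma> @ [\<alpha>])) f = \<sigma> @ [\<alpha>] \<longrightarrow> \<not> follows W (length (\<sigma> @ [\<alpha>])) f)"
    unfolding small_at_def by blast
  then obtain V where V: "\<And>\<alpha> \<rho>. small_at X (\<sigma> @ [\<alpha>]) \<Longrightarrow> V \<alpha> \<rho> \<in> U"
    and X: "\<And>\<alpha> f. small_at X (\<sigma> @ [\<alpha>]) \<Longrightarrow> f \<in> X \<Longrightarrow> prefix (length (\<sigma> @ [\<alpha>])) f = \<sigma> @ [\<alpha>] \<Longrightarrow>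
      \<not> follows (V \<alpha>) (length (\<sigma> @ [\<alpha>])) f"
    by - (drule choice, blast)
  \<comment> \<open>Glue the codes: at the level of the stem, force an entry whose extension is
    small; later, that entry, read off at position \<open>length \<sigma>\<close>, selects the code.
    On shorter lists the value is irrelevant but still in \<open>U\<close>.\<close>
  define W where "W \<rho> = (if length \<rho> = length \<sigma> then ?A
    else if small_at X (\<sigma> @ [\<rho> ! length \<sigma>]) then V (\<rho> ! length \<sigma>) \<rho> else K)" for \<rho>
  have W: "W \<rho> \<in> U" for \<rho>
    unfolding W_def using assms V K_in_U by auto
  have "\<not> follows W (length \<sigma>) f" if f: "f \<in> X" "prefix (length \<sigma>) f = \<sigma>" for f
  proof
    assume fW: "follows W (length \<sigma>) f"
    then have "f (length \<sigma>) \<in> W (prefix (length \<sigma>) f)"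
      unfolding follows_def by blast
    then have small: "small_at X (\<sigma> @ [f (length \<sigma>)])"
      by (simp add: W_def)
    have "follows (V (f (length \<sigma>))) (length (\<sigma> @ [f (length \<sigma>)])) f"
      using fW by (rule follows_mono) (auto simp: W_def small)
    with X[OF small f(1)] f(2) show False
      by simp
  qed
  with W show ?thesis
    unfolding small_at_def by blast
qed

text \<open>If \<open>X\<close> is not small at the stem, the entries with small extension cannot
  form a set in \<open>U\<close>, so maximality of the ultrafilter puts their complement
  there.\<close>

lemma preserve_small_in_U: "preserve {\<rho>. small_at X \<rho>} \<sigma> \<in> U"
proof (cases "small_at X \<sigma>")
  case True
  then show ?thesis
    using small_at_snoc[OF True] by (simp add: preserve_def)
next
  case False
  then have "K - {\<alpha> \<in> K. small_at X (\<sigma> @ [\<alpha>])} \<in> U"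
    using small_at_of_snoc by (intro diff_in_U) auto
  moreover have "K - {\<alpha> \<in> K. small_at X (\<sigma> @ [\<alpha>])} = preserve {\<rho>. small_at X \<rho>} \<sigma>"
    using False by (auto simp: preserve_def)
  ultimately show ?thesis
    by simp
qed

text \<open>A sequence following \<open>preserve\<close> for smallness of \<open>Y\<close> keeps the
  status of the stem forever, so one whose status changes later cannot follow it.\<close>

lemma small_atI_preserve:
  assumes "\<And>f. f \<in> X \<Longrightarrow> prefix (length \<sigma>) f = \<sigma> \<Longrightarrow>
    \<exists>i\<ge>length \<sigma>. small_at Y (prefix i f) \<noteq> small_at Y \<sigma>"
  shows "small_at X \<sigma>"
  unfolding small_at_def
proof (intro exI[of _ "preserve {\<rho>. small_at Y \<rho>}"] conjI allI ballI impI notI preserve_small_in_U)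
  fix f
  assume f: "f \<in> X" "prefix (length \<sigma>) f = \<sigma>"
    "follows (preserve {\<rho>. small_at Y \<rho>}) (length \<sigma>) f"
  with assms[OF f(1,2)] follows_preserve[OF f(3)] show False
    by auto
qed

section \<open>Hulls and their null differences\<close>

definition hull :: "(nat \<Rightarrow> 'a) set \<Rightarrow> (nat \<Rightarrow> 'a) set" where
  "hull A = {f. \<exists>m. \<forall>i\<ge>m. \<not> small_at A (prefix i f)}"

text \<open>Smallness at the stem persists along \<open>preserve\<close>, which rules out the hull.
  With the next lemma, the hull is decided at every stem.\<close>

lemma small_at_hull:
  assumes "small_at A \<sigma>"
  shows "small_at (hull A) \<sigma>"
proof (rule small_atI_preserve[of _ _ A])
  fix f
  assume "f \<in> hull A"
  then obtain m where "\<forall>i\<ge>m. \<not> small_at A (prefix i f)"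
    unfolding hull_def by (elim CollectE exE)
  with assms show "\<exists>i\<ge>length \<sigma>. small_at A (prefix i f) \<noteq> small_at A \<sigma>"
    by (intro exI[of _ "max m (length \<sigma>)"]) simp
qed

lemma small_at_compl_hull:
  assumes "\<not> small_at A \<sigma>"
  shows "small_at (- hull A) \<sigma>"
proof (rule small_atI_preserve[of _ _ A])
  fix f
  assume "f \<in> - hull A"
  with assms show "\<exists>i\<ge>length \<sigma>. small_at A (prefix i f) \<noteq> small_at A \<sigma>"
    by (simp add: hull_def)
qed

text \<open>Where \<open>A\<close> is small, so is its hull; elsewhere the larger \<open>X\<close>
  is not small, and measurability makes \<open>- X\<close> small.\<close>

lemma null_hull_diff_measurable:
  assumes "U_measurable K U X" "A \<subseteq> X"
  shows "null (hull A - X)"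
proof (rule nullI)
  fix \<sigma>
  show "small_at (hull A - X) \<sigma>"
  proof (cases "small_at A \<sigma>")
    case True
    then show ?thesis
      using small_at_hull small_at_subset by blast
  next
    case False
    then have not_small: "\<not> small_at X \<sigma>"
      using assms(2) small_at_subset by blast
    \<comment> \<open>Measurability speaks only of stems over \<open>K\<close>; no element of
      \<open>X\<close> extends any other stem, so \<open>X\<close> would be vacuously small
      there.\<close>
    have "\<sigma> \<in> lists K"
    proof (rule ccontr)
      assume "\<sigma> \<notin> lists K"
      moreover have "prefix (length \<sigma>) f \<in> lists K" if "f \<in> X" for f
        using that assms(1) unfolding U_measurable_def inf_seqs_def in_lists_conv_set by auto
      ultimately have "prefix (length \<sigma>) f \<noteq> \<sigma>" if "f \<in> X" for f
        using that by metis
      then have "small_at X \<sigma>"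
        unfolding small_at_def using K_in_U by (intro exI[of _ "\<lambda>_. K"]) auto
      with not_small show False ..
    qed
    with not_small have "small_at (- X) \<sigma>"
      using assms(1) unfolding U_measurable_iff by blast
    then show ?thesis
      by (rule small_at_subset) blast
  qed
qed

lemma null_hull_UN:
  fixes A :: "nat \<Rightarrow> (nat \<Rightarrow> 'a) set"
  shows "null (hull (\<Union>n. A n) - (\<Union>n. hull (A n)))" (is "null ?E")
proof (rule nullI, rule ccontr)
  fix \<sigma>
  assume E: "\<not> small_at ?E \<sigma>"
  \<comment> \<open>If \<open>A n\<close> were not small at \<open>\<rho>\<close>, the complement of
    its hull would be, and that complement contains \<open>?E\<close>.\<close>
  have small_A: "small_at (A n) \<rho>" if "\<not> small_at ?E \<rho>" for n \<rho>
    using that small_at_compl_hull[of "A n" \<rho>] small_at_subset[of "- hull (A n)" \<rho> ?E] by blast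
  \<comment> \<open>Intersecting with \<open>hull ?E\<close> makes local smallness global: where
    \<open>?E\<close> is small, so is its hull, and elsewhere \<open>A n\<close> is small. Fusion
    over \<open>n\<close> then applies, and at \<open>\<sigma>\<close> the part outside
    \<open>hull ?E\<close> is small too.\<close>
  have "null (A n \<inter> hull ?E)" for n
  proof (rule nullI)
    fix \<rho>
    show "small_at (A n \<inter> hull ?E) \<rho>"
      using small_A[of \<rho> n] small_at_hull[of ?E \<rho>]
      by (cases "small_at ?E \<rho>") (auto elim: small_at_subset)
  qed
  then have "small_at (\<Union>n. A n \<inter> hull ?E) \<sigma>"
    by (intro null_imp_small_at null_UN)
  then have "small_at ((\<Union>n. A n \<inter> hull ?E) \<union> - hull ?E) \<sigma>"
    using small_at_compl_hull[OF E] by (rule small_at_Un)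
  then have "small_at (\<Union>n. A n) \<sigma>"
    by (rule small_at_subset) blast
  then have "small_at ?E \<sigma>"
    using small_at_hull small_at_subset by blast
  with E show False ..
qed

section \<open>Suslin's operation\<close>

lemma suslin_operation_measurable:
  fixes X :: "nat list \<Rightarrow> (nat \<Rightarrow> 'a) set"
  assumes meas: "\<And>\<tau>. U_measurable K U (X \<tau>)"
  shows "U_measurable K U (\<Union>g. \<Inter>n. X (prefix n g))"
proof -
  define A where "A = suslin_above X"
  define N where "N = (\<Union>\<tau>. hull (A \<tau>) - X \<tau>) \<union> (\<Union>\<tau>. hull (A \<tau>) - (\<Union>n. hull (A (\<tau> @ [n]))))"
  have small_N: "small_at N \<sigma>" for \<sigma>
    unfolding N_def
  proof (intro small_at_Un null_imp_small_at null_UN_countable)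
    fix \<tau>
    show "null (hull (A \<tau>) - X \<tau>)"
      unfolding A_def by (intro null_hull_diff_measurable meas suslin_above_subset)
    show "null (hull (A \<tau>) - (\<Union>n. hull (A (\<tau> @ [n]))))"
      using null_hull_UN[of "\<lambda>n. A (\<tau> @ [n])"] suslin_above_step[of X \<tau>] by (simp add: A_def)
  qed
  have hull_subset: "hull (A []) - N \<subseteq> A []"
  proof
    fix f
    assume f: "f \<in> hull (A []) - N"
    \<comment> \<open>Outside \<open>N\<close>, membership in a hull passes to some immediate
      extension of the index, and it also gives membership in the corresponding
      \<open>X \<tau>\<close>.\<close>
    then have "\<exists>n. f \<in> hull (A (\<tau> @ [n]))" if "f \<in> hull (A \<tau>)" for \<tau>
      using that unfolding N_def by blast
    with f obtain g where "\<And>k. f \<in> hull (A (prefix k g))"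
      using prefix_chain_exists[of "\<lambda>\<tau>. f \<in> hull (A \<tau>)"] by blast
    with f have "f \<in> X (prefix k g)" for k
      unfolding N_def by blast
    then show "f \<in> A []"
      unfolding A_def suslin_above_Nil by blast
  qed
  \<comment> \<open>The sets \<open>- hull (A [])\<close> and \<open>N\<close> are small at such a
    stem and together cover \<open>- A []\<close>.\<close>
  have "small_at (- A []) \<sigma>" if "\<not> small_at (A []) \<sigma>" for \<sigma>
    using hull_subset
    by (intro small_at_subset[OF small_at_Un[OF small_at_compl_hull[OF that] small_N]]) blast
  moreover have "A [] \<subseteq> inf_seqs K"
    using meas[of "[]"] suslin_above_subset[of X "[]"] unfolding A_def U_measurable_def by blast
  ultimately have "U_measurable K U (A [])"
    unfolding U_measurable_iff by blast
  then show ?thesis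
    unfolding A_def suslin_above_Nil .
qed

end

theorem theorem5p10:
  fixes \<kappa> :: "'a rel" and U :: "'a set set" and X :: "nat list \<Rightarrow> (nat \<Rightarrow> 'a) set"
  assumes "Card_order \<kappa>"
    and "ultrafilter_on (Field \<kappa>) U"
    and "\<And>\<tau>. U_measurable (Field \<kappa>) U (X \<tau>)"
  shows "U_measurable (Field \<kappa>) U (\<Union>f :: nat \<Rightarrow> nat. \<Inter>n. X (prefix n f))"
proof -
  interpret ultrafilter_set "Field \<kappa>" U
    by (rule ultrafilter_set.intro) (rule assms(2))
  show ?thesis
    by (rule suslin_operation_measurable) (rule assms(3))
qed

end
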